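(* Let $X_n$ denote the number of sign changes of a (random weighted) Motzkin walk of length $n$. Let $\delta=P'(1)$ be the drift. Then, as $n\to\infty$: 1. For $\delta\neq 0$, $X_n$ converges in distribution to a geometric distribution: $$X_n\stackrel{d}{\to}\operatorname{Geom}(\lambda),\qquad \lambda=\begin{cases}\dfrac{p_1}{p_{-1}}, & \text{for }\delta<0,\\[2mm] \dfrac{p_{-1}}{p_1}, & \text{for }\delta>0.\end{cases}$$ 2. For $\delta=0$, the normalized random variable converges in distribution to a half-normal distribution: $$\frac{X_n}{\sqrt n}\stackrel{d}{\to}\mathcal{H}\left(\frac12\sqrt{\frac{P''(1)}{P(1)}}\right).$$
   Context: A Motzkin walk of length $n$ is a sequence of altitudes $\omega=(\omega_0,\dots,\omega_n)$ with $\omega_0=0$ and $\omega_i-\omega_{i-1}\in\{-1,0,1\}$ (no positivity constraint). The steps $-1,0,1$ carry weights $p_{-1},p_0,p_1>0$; the weight of a walk is the product of the weights of its steps. The jump polynomial is $P(u)=p_{-1}u^{-1}+p_0+p_1u$. A random walk of length $n$ is drawn among all walks of length $n$ with probability proportional to its weight (the total weight is $P(1)^n$). Each node $\omega_i$ gets the sign $+$ if $\omega_i>0$, $-$ if $\omega_i<0$, and $0$ if $\omega_i=0$. A sign change is an occurrence, in the resulting sequence of signs, of a pattern $+(0)-$ or $-(0)+$, where $(0)$ denotes a non-empty sequence of $0$'s. $\operatorname{Geom}(p)$ is the distribution on $\{0,1,2,\dots\}$ with probabilities $(1-p)^kp$. $\mathcal{H}(\sigma)$ is the half-normal distribution with density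 $\sqrt{\frac{2}{\pi\sigma^2}}\exp\left(-\frac{x^2}{2\sigma^2}\right)$ on $x\ge 0$.
   Formalization: With Geom(p) having probabilities (1-p)^k p, the limit for nonzero drift is corrected from Geom(λ) to Geom(1-λ), i.e. masses (1-λ)λ^k; for weights (p_{-1},p_0,p_1)=(4,2,1) the limiting mass at 0 is 3/4, not λ=1/4. *)

theory Defs
  imports "HOL-Probability.Probability"
begin

text \<open>
  A walk of length \<open>n\<close> is the list of its \<open>n + 1\<close> altitudes.  The step weights
  \<open>p\<^sub>-\<^sub>1, p\<^sub>0, p\<^sub>1\<close> are \<open>p (-1), p 0, p 1\<close>; other values of \<open>p\<close> are never used.
\<close>

definition motzkin_walks :: "nat \<Rightarrow> int list set" where
  "motzkin_walks n =
     {\<omega>. length \<omega> = n + 1 \<and> \<omega> ! 0 = 0 \<and> (\<forall>i<n. \<omega> ! (i + 1) - \<omega> ! i \<in> {-1, 0, 1})}"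

definition walk_weight :: "(int \<Rightarrow> real) \<Rightarrow> int list \<Rightarrow> real" where
  "walk_weight p \<omega> = (\<Prod>i<length \<omega> - 1. p (\<omega> ! (i + 1) - \<omega> ! i))"

definition random_walk :: "(int \<Rightarrow> real) \<Rightarrow> nat \<Rightarrow> int list pmf" where
  "random_walk p n =
     embed_pmf (\<lambda>\<omega>. if \<omega> \<in> motzkin_walks n
                    then walk_weight p \<omega> / (\<Sum>\<omega>'\<in>motzkin_walks n. walk_weight p \<omega>') else 0)"

definition jump_poly :: "(int \<Rightarrow> real) \<Rightarrow> real \<Rightarrow> real" where
  "jump_poly p u = p (-1) / u + p 0 + p 1 * u"

definition drift :: "(int \<Rightarrow> real) \<Rightarrow> real" where
  "drift p = deriv (jump_poly p) 1"

text \<open>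
  An occurrence of \<open>+(0)-\<close> or \<open>-(0)+\<close> is identified with the positions \<open>i\<close>, \<open>j\<close> of its two
  nonzero ends; \<open>i + 1 < j\<close> says that the block of zeros is not empty.
\<close>

definition sign_changes :: "int list \<Rightarrow> nat" where
  "sign_changes \<omega> =
     card {(i, j). i + 1 < j \<and> j < length \<omega> \<and> (\<forall>k. i < k \<and> k < j \<longrightarrow> \<omega> ! k = 0) \<and>
                   (\<omega> ! i > 0 \<and> \<omega> ! j < 0 \<or> \<omega> ! i < 0 \<and> \<omega> ! j > 0)}"

definition half_normal :: "real \<Rightarrow> real measure" where
  "half_normal \<sigma> =
     density lborel (\<lambda>x. ennreal (if x \<ge> 0
       then sqrt (2 / (pi * \<sigma>\<^sup>2)) * exp (- x\<^sup>2 / (2 * \<sigma>\<^sup>2)) else 0))"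

text \<open>
  The law of \<open>f X\<close> for \<open>X\<close> distributed as \<open>M\<close>, as a measure on the Borel sets of the reals.
\<close>

definition real_law :: "'a pmf \<Rightarrow> ('a \<Rightarrow> real) \<Rightarrow> real measure" where
  "real_law M f = distr (measure_pmf M) borel f"

text \<open>
  The library's \<^const>\<open>geometric_pmf\<close> with parameter \<open>q\<close> gives \<open>k\<close> the mass \<open>(1 - q)^k * q\<close>.
  The limit law of the number of sign changes in the case of nonzero drift gives \<open>k\<close> the mass
  \<open>(1 - \<lambda>) * \<lambda>^k\<close>, where \<open>\<lambda>\<close> is the ratio of the smaller to the larger of \<open>p\<^sub>1\<close> and \<open>p\<^sub>-\<^sub>1\<close>.
  So \<open>\<lambda>\<close> is the ratio of successive masses and the parameter of \<^const>\<open>geometric_pmf\<close> is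
  \<open>1 - \<lambda>\<close>.  With \<open>\<lambda>\<close> itself as parameter the result would be false: for
  negative drift, walks with \<open>p\<^sub>1 / p\<^sub>-\<^sub>1\<close> close to \<open>0\<close> rarely change sign, and the limiting mass
  at \<open>0\<close> is close to \<open>1\<close>, not to \<open>0\<close>.
\<close>

definition geom_ratio :: "(int \<Rightarrow> real) \<Rightarrow> real" where
  "geom_ratio p = (if drift p < 0 then p 1 / p (-1) else p (-1) / p 1)"

text \<open>The function in the definition of \<^const>\<open>random_walk\<close> is a probability mass function.\<close>

lemma finite_motzkin_walks: "finite (motzkin_walks n)"
proof (rule finite_subset)
  have bound: "\<bar>\<omega> ! i\<bar> \<le> int i" if "\<omega> \<in> motzkin_walks n" "i \<le> n" for \<omega> i
    using that(2)
  proof (induction i)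
    case 0
    then show ?case using that(1) by (simp add: motzkin_walks_def)
  next
    case (Suc i)
    then have "\<bar>\<omega> ! i\<bar> \<le> int i" by simp
    moreover have "\<omega> ! (i + 1) - \<omega> ! i \<in> {-1, 0, 1}"
      using that(1) Suc.prems unfolding motzkin_walks_def by (simp add: Suc_le_eq)
    ultimately show ?case by auto
  qed
  have "set \<omega> \<subseteq> {- int n..int n}" if w: "\<omega> \<in> motzkin_walks n" for \<omega>
  proof
    fix x assume "x \<in> set \<omega>"
    then obtain i where i: "i < length \<omega>" "x = \<omega> ! i" by (auto simp: in_set_conv_nth)
    then have "i \<le> n" using w by (simp add: motzkin_walks_def)
    then show "x \<in> {- int n..int n}" using bound[OF w, of i] i by auto
  qed
  then show "motzkin_walks n \<subseteq> {\<omega>. set \<omega> \<subseteq> {- int n..int n} \<and> length \<omega> = n + 1}"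
    by (auto simp: motzkin_walks_def)
  show "finite {\<omega>. set \<omega> \<subseteq> {- int n..int n} \<and> length \<omega> = n + 1}"
    by (rule finite_lists_length_eq) simp
qed

lemma pmf_random_walk:
  assumes p: "p (-1) > 0" "p 0 > 0" "p 1 > 0"
  shows "pmf (random_walk p n) \<omega> =
    (if \<omega> \<in> motzkin_walks n
     then walk_weight p \<omega> / (\<Sum>\<omega>'\<in>motzkin_walks n. walk_weight p \<omega>') else 0)"
proof -
  define S where "S = (\<Sum>\<omega>'\<in>motzkin_walks n. walk_weight p \<omega>')"
  define f where "f = (\<lambda>\<omega>. if \<omega> \<in> motzkin_walks n then walk_weight p \<omega> / S else 0)"
  have pos: "walk_weight p \<omega> > 0" if "\<omega> \<in> motzkin_walks n" for \<omega>
    unfolding walk_weight_def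
  proof (rule prod_pos)
    fix i assume "i \<in> {..<length \<omega> - 1}"
    then have "\<omega> ! (i + 1) - \<omega> ! i \<in> {-1, 0, 1}"
      using that by (auto simp: motzkin_walks_def)
    then show "p (\<omega> ! (i + 1) - \<omega> ! i) > 0"
      using p by (elim insertE) auto
  qed
  have "replicate (n + 1) 0 \<in> motzkin_walks n"
    by (auto simp: motzkin_walks_def simp del: replicate_Suc)
  then have "motzkin_walks n \<noteq> {}" by blast
  then have S: "S > 0"
    unfolding S_def using pos by (intro sum_pos finite_motzkin_walks) auto
  have nonneg: "f \<omega> \<ge> 0" for \<omega>
    using pos S by (auto simp: f_def less_imp_le)
  have "(\<integral>\<^sup>+\<omega>. ennreal (f \<omega>) \<partial>count_space UNIV) = (\<Sum>\<omega>\<in>motzkin_walks n. ennreal (f \<omega>))"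
    by (rule nn_integral_count_space'[OF finite_motzkin_walks]) (auto simp: f_def)
  also have "\<dots> = ennreal (\<Sum>\<omega>\<in>motzkin_walks n. f \<omega>)"
    using nonneg by simp
  also have "(\<Sum>\<omega>\<in>motzkin_walks n. f \<omega>) = 1"
    using S by (simp add: f_def S_def flip: sum_divide_distrib)
  finally have "(\<integral>\<^sup>+\<omega>. ennreal (f \<omega>) \<partial>count_space UNIV) = 1" by simp
  then have "pmf (embed_pmf f) \<omega> = f \<omega>"
    by (intro pmf_embed_pmf nonneg)
  then show ?thesis
    unfolding random_walk_def f_def S_def .
qed

end

theory Submission
  imports Defs "HOL-Real_Asymp.Real_Asymp"
begin

text \<open>
  The proof rests on an exact formula.  Normalise the weights to probabilities and let \<open>g\<close> and \<open>w\<close>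
  be the larger and the smaller of \<open>p 1\<close> and \<open>p (-1)\<close>.  For positive \<open>k\<close>,

    \<open>P (X\<^sub>n \<ge> k) = (w / g)\<^sup>k * P (\<tau> + T \<le> n)\<close>,

  where \<open>\<tau>\<close> is the time of the first nonzero step and \<open>T\<close> is an independent copy of the time that a
  walk with up-step probability \<open>g\<close> and down-step probability \<open>w\<close> needs to reach the altitude \<open>2k\<close>.
  The reason is a weighted reflection principle: after the first nonzero step the walk has \<open>k\<close> sign
  changes if and only if it makes \<open>k\<close> successive passages over two levels between \<open>1\<close> and \<open>-1\<close> in
  alternating directions.  Reflecting those that go in the unlikely direction turns them into a
  single passage over \<open>2k\<close> levels, and changes the weight by a factor that depends only on the number
  of levels (\<open>tail_eq_reach\<close>).  Averaging over the direction of the first nonzero step gives the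
  formula (\<open>tail_origin\<close>, \<open>prob_sign_changes_ge\<close>).  The delay \<open>\<tau>\<close> does not matter in the limit,
  since it costs at most one more level (\<open>late_reach_ge\<close>).

  If the drift is nonzero, the reflected walk drifts upwards and reaches every altitude
  (\<open>reach_tendsto_1\<close>), so \<open>P (X\<^sub>n \<ge> k)\<close> tends to \<open>(w / g)\<^sup>k\<close>.  If the drift is zero, the first factor
  is one, and the reflection principle for the maximum of a symmetric walk (\<open>reach_reflection\<close>)
  together with a central limit theorem for its endpoint (\<open>endpoint_clt\<close>) shows that
  \<open>P (X\<^sub>n \<ge> x \<surd>n)\<close>, for nonnegative \<open>x\<close>, tends to \<open>2 (1 - \<Phi> (2x / \<sigma>))\<close> with \<open>\<sigma>\<close> the standard deviation of a step,
  which is the tail of the half-normal law with parameter \<open>\<sigma> / 2\<close>.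
\<close>

section \<open>Weighted sums over walks\<close>

definition walks_from :: "int \<Rightarrow> nat \<Rightarrow> int list set" where
  "walks_from x n =
     {\<omega>. length \<omega> = n + 1 \<and> \<omega> ! 0 = x \<and> (\<forall>i<n. \<omega> ! (i + 1) - \<omega> ! i \<in> {-1, 0, 1})}"

text \<open>
  For weights of total mass one this is an expectation over the random walk.  The starting point
  is a parameter because inductions on walks remove the first step.
\<close>

definition walk_sum :: "(int \<Rightarrow> real) \<Rightarrow> int \<Rightarrow> nat \<Rightarrow> (int list \<Rightarrow> 'a::real_vector) \<Rightarrow> 'a" where
  "walk_sum p x n f = (\<Sum>\<omega>\<in>walks_from x n. walk_weight p \<omega> *\<^sub>R f \<omega>)"

lemma motzkin_walks_eq: "motzkin_walks n = walks_from 0 n"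
  by (simp add: motzkin_walks_def walks_from_def)

lemma walks_from_0: "walks_from x 0 = {[x]}"
  by (auto simp: walks_from_def length_Suc_conv)

lemma Cons_in_walks_from_Suc:
  "y # \<omega> \<in> walks_from x (Suc n) \<longleftrightarrow> y = x \<and> (\<exists>e\<in>{-1, 0, 1}. \<omega> \<in> walks_from (x + e) n)"
proof -
  have "(\<forall>i<Suc n. (y # \<omega>) ! (i + 1) - (y # \<omega>) ! i \<in> {-1, 0, 1}) \<longleftrightarrow>
        \<omega> ! 0 - y \<in> {-1, 0, 1} \<and> (\<forall>i<n. \<omega> ! (i + 1) - \<omega> ! i \<in> {-1, 0, 1})"
    by (subst All_less_Suc2) simp
  moreover have "\<omega> ! 0 - x \<in> {-1, 0, 1} \<longleftrightarrow> (\<exists>e\<in>{-1, 0, 1}. \<omega> ! 0 = x + e)"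
    by auto
  ultimately show ?thesis
    unfolding walks_from_def by auto
qed

lemma walks_from_Suc:
  "walks_from x (Suc n) = (\<Union>e\<in>{-1, 0, 1}. (#) x ` walks_from (x + e) n)"
proof (intro set_eqI)
  fix \<omega>
  show "\<omega> \<in> walks_from x (Suc n) \<longleftrightarrow> \<omega> \<in> (\<Union>e\<in>{-1, 0, 1}. (#) x ` walks_from (x + e) n)"
  proof (cases \<omega>)
    case Nil
    then show ?thesis by (auto simp: walks_from_def)
  next
    case (Cons y ys)
    then show ?thesis unfolding Cons Cons_in_walks_from_Suc by auto
  qed
qed

lemma finite_walks_from: "finite (walks_from x n)"
  by (induction n arbitrary: x) (auto simp: walks_from_0 walks_from_Suc)

lemma walk_weight_Cons:
  assumes "\<omega> \<in> walks_from y n"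
  shows "walk_weight p (x # \<omega>) = p (y - x) * walk_weight p \<omega>"
proof -
  have len: "length \<omega> = Suc n" and "\<omega> ! 0 = y"
    using assms by (auto simp: walks_from_def)
  then show ?thesis
    by (simp add: walk_weight_def prod.lessThan_Suc_shift del: prod.lessThan_Suc)
qed

lemma walk_sum_0: "walk_sum p x 0 f = f [x]"
  by (simp add: walk_sum_def walks_from_0 walk_weight_def)

text \<open>
  The first-step decomposition, from which the recursions for all statistics of walks are derived.
\<close>

lemma walk_sum_Suc:
  "walk_sum p x (Suc n) f =
     p (-1) *\<^sub>R walk_sum p (x - 1) n (\<lambda>\<omega>. f (x # \<omega>)) +
     p 0 *\<^sub>R walk_sum p x n (\<lambda>\<omega>. f (x # \<omega>)) +
     p 1 *\<^sub>R walk_sum p (x + 1) n (\<lambda>\<omega>. f (x # \<omega>))"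
proof -
  have start: "\<omega> ! 0 = y" if "\<omega> \<in> walks_from y n" for \<omega> y
    using that by (simp add: walks_from_def)
  have "walk_sum p x (Suc n) f =
      (\<Sum>e\<in>{-1, 0, 1}. \<Sum>\<omega>\<in>(#) x ` walks_from (x + e) n. walk_weight p \<omega> *\<^sub>R f \<omega>)"
    unfolding walk_sum_def walks_from_Suc
    by (rule sum.UNION_disjoint) (auto simp: finite_walks_from dest!: start)
  also have "\<dots> = (\<Sum>e\<in>{-1, 0, 1}. p e *\<^sub>R walk_sum p (x + e) n (\<lambda>\<omega>. f (x # \<omega>)))"
  proof (intro sum.cong refl)
    fix e :: int
    have "(\<Sum>\<omega>\<in>(#) x ` walks_from (x + e) n. walk_weight p \<omega> *\<^sub>R f \<omega>) =
        (\<Sum>\<omega>\<in>walks_from (x + e) n. walk_weight p (x # \<omega>) *\<^sub>R f (x # \<omega>))"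
      by (subst sum.reindex) (auto simp: inj_on_def)
    also have "\<dots> = (\<Sum>\<omega>\<in>walks_from (x + e) n. p e *\<^sub>R walk_weight p \<omega> *\<^sub>R f (x # \<omega>))"
      by (intro sum.cong refl) (simp add: walk_weight_Cons)
    finally show "(\<Sum>\<omega>\<in>(#) x ` walks_from (x + e) n. walk_weight p \<omega> *\<^sub>R f \<omega>) =
        p e *\<^sub>R walk_sum p (x + e) n (\<lambda>\<omega>. f (x # \<omega>))"
      by (simp add: walk_sum_def scaleR_sum_right)
  qed
  finally show ?thesis by simp
qed

lemma walk_sum_cong:
  "(\<And>\<omega>. \<omega> \<in> walks_from x n \<Longrightarrow> f \<omega> = g \<omega>) \<Longrightarrow> walk_sum p x n f = walk_sum p x n g"
  by (simp add: walk_sum_def)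

lemma walk_sum_add: "walk_sum p x n (\<lambda>\<omega>. f \<omega> + g \<omega>) = walk_sum p x n f + walk_sum p x n g"
  by (simp add: walk_sum_def scaleR_add_right sum.distrib)

lemma walk_sum_const:
  "p (-1) + p 0 + p 1 = 1 \<Longrightarrow> walk_sum p x n (\<lambda>_. c) = c"
  by (induction n arbitrary: x) (simp_all add: walk_sum_0 walk_sum_Suc flip: scaleR_add_left)

text \<open>
  Rescaling the step weights multiplies the weight of every walk of length \<open>n\<close> by the same factor,
  so the weights may be taken to be probabilities.
\<close>

lemma random_walk_scale:
  assumes c: "c > 0" and p: "p (-1) > 0" "p 0 > 0" "p 1 > 0"
  shows "random_walk (\<lambda>e. p e / c) n = random_walk p n"
proof (rule pmf_eqI)
  fix \<omega>
  have w: "walk_weight (\<lambda>e. p e / c) \<omega> = walk_weight p \<omega> / c ^ n" if "\<omega> \<in> motzkin_walks n" for \<omega>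
    using that by (simp add: walk_weight_def motzkin_walks_def prod_dividef)
  have "(\<Sum>\<omega>\<in>motzkin_walks n. walk_weight (\<lambda>e. p e / c) \<omega>) =
        (\<Sum>\<omega>\<in>motzkin_walks n. walk_weight p \<omega>) / c ^ n"
    by (simp add: w sum_divide_distrib)
  then show "pmf (random_walk (\<lambda>e. p e / c) n) \<omega> = pmf (random_walk p n) \<omega>"
    using c p by (simp add: pmf_random_walk w)
qed

lemma integral_random_walk:
  fixes f :: "int list \<Rightarrow> 'a::{banach, second_countable_topology}"
  assumes p: "p (-1) > 0" "p 0 > 0" "p 1 > 0" and sum1: "p (-1) + p 0 + p 1 = 1"
  shows "(\<integral>\<omega>. f \<omega> \<partial>measure_pmf (random_walk p n)) = walk_sum p 0 n f"
proof -
  have "(\<Sum>\<omega>\<in>motzkin_walks n. walk_weight p \<omega>) = 1"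
    using walk_sum_const[OF sum1, of 0 n "1::real"] by (simp add: walk_sum_def motzkin_walks_eq)
  then have pmf: "pmf (random_walk p n) \<omega> = (if \<omega> \<in> walks_from 0 n then walk_weight p \<omega> else 0)" for \<omega>
    using p by (simp add: pmf_random_walk motzkin_walks_eq)
  have "(\<integral>\<omega>. f \<omega> \<partial>measure_pmf (random_walk p n)) =
      (\<Sum>\<omega>\<in>walks_from 0 n. pmf (random_walk p n) \<omega> *\<^sub>R f \<omega>)"
    by (rule integral_measure_pmf[OF finite_walks_from])
       (simp add: pmf set_pmf_iff split: if_splits)
  then show ?thesis by (simp add: pmf walk_sum_def)
qed

lemma prob_random_walk:
  assumes p: "p (-1) > 0" "p 0 > 0" "p 1 > 0" and sum1: "p (-1) + p 0 + p 1 = 1"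
  shows "measure_pmf.prob (random_walk p n) {\<omega>. Q \<omega>} = walk_sum p 0 n (\<lambda>\<omega>. of_bool (Q \<omega>))"
proof -
  have "measure_pmf.prob (random_walk p n) {\<omega>. Q \<omega>} =
      (\<integral>\<omega>. indicator {\<omega>. Q \<omega>} \<omega> \<partial>measure_pmf (random_walk p n))"
    by simp
  also have "\<dots> = walk_sum p 0 n (\<lambda>\<omega>. of_bool (Q \<omega>))"
    unfolding integral_random_walk[OF assms] by (rule walk_sum_cong) (simp add: indicator_def)
  finally show ?thesis .
qed

section \<open>Sign changes as a scan of the walk\<close>

text \<open>
  A scan of the walk from left to right that remembers in \<open>s\<close> the sign of the last nonzero altitude
  (\<open>0\<close> if there was none).  In contrast to the count of pairs of positions, it can be computed step by
  step.
\<close>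

fun alternations :: "int \<Rightarrow> int list \<Rightarrow> nat" where
  "alternations s [] = 0"
| "alternations s (y # ys) =
     (if y = 0 then alternations s ys else of_bool (s * y < 0) + alternations (sgn y) ys)"

text \<open>
  A pattern of \<open>x # \<omega>\<close> either lies within \<open>\<omega>\<close> or starts at \<open>x\<close>; in the second case it must end at
  the first nonzero altitude of \<open>\<omega>\<close>, so there is at most one such pattern.
\<close>

lemma sign_changes_Cons:
  "sign_changes (x # \<omega>) = sign_changes \<omega> +
     of_bool (\<exists>j<length \<omega>. j > 0 \<and> (\<forall>k<j. \<omega> ! k = 0) \<and> x * \<omega> ! j < 0)"
proof -
  let ?P = "\<lambda>\<omega> i j. i + 1 < j \<and> j < length \<omega> \<and> (\<forall>k. i < k \<and> k < j \<longrightarrow> \<omega> ! k = 0) \<and>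
                   (\<omega> ! i > 0 \<and> \<omega> ! j < 0 \<or> \<omega> ! i < 0 \<and> \<omega> ! j > (0::int))"
  let ?Q = "\<lambda>j. j < length \<omega> \<and> j > 0 \<and> (\<forall>k<j. \<omega> ! k = 0) \<and> x * \<omega> ! j < 0"
  let ?A = "{(i, j). ?P \<omega> i j}" and ?B = "{j. ?Q j}"
  let ?f = "\<lambda>(i, j). (Suc i, Suc j)" and ?g = "\<lambda>j. (0::nat, Suc j)"
  have finA: "finite ?A"
    by (rule finite_subset[of _ "{..length \<omega>} \<times> {..length \<omega>}"]) auto
  have finB: "finite ?B" by simp
  have shift: "?P (x # \<omega>) (Suc i) (Suc j) \<longleftrightarrow> ?P \<omega> i j" for i j
  proof -
    have "(\<forall>k. Suc i < k \<and> k < Suc j \<longrightarrow> (x # \<omega>) ! k = 0) \<longleftrightarrow>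
          (\<forall>k. i < k \<and> k < j \<longrightarrow> \<omega> ! k = 0)"
      by (metis Suc_less_eq Suc_less_eq2 nth_Cons_Suc)
    then show ?thesis by simp
  qed
  have zero: "?P (x # \<omega>) 0 (Suc j) \<longleftrightarrow> ?Q j" for j
  proof -
    have "(\<forall>k. 0 < k \<and> k < Suc j \<longrightarrow> (x # \<omega>) ! k = 0) \<longleftrightarrow> (\<forall>k<j. \<omega> ! k = 0)"
      by (metis Suc_less_eq gr0_conv_Suc nth_Cons_Suc zero_less_Suc)
    then show ?thesis by (auto simp: mult_less_0_iff)
  qed
  have split: "{(i, j). ?P (x # \<omega>) i j} = ?f ` ?A \<union> ?g ` ?B"
  proof (intro set_eqI)
    fix ij :: "nat \<times> nat"
    obtain i j where ij: "ij = (i, j)" by force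
    show "ij \<in> {(i, j). ?P (x # \<omega>) i j} \<longleftrightarrow> ij \<in> ?f ` ?A \<union> ?g ` ?B"
    proof (cases j)
      case 0
      then show ?thesis by (auto simp: ij)
    next
      case (Suc j')
      show ?thesis
      proof (cases i)
        case 0
        show ?thesis unfolding ij 0 Suc mem_Collect_eq prod.case zero by force
      next
        case (Suc i')
        show ?thesis unfolding ij \<open>j = Suc j'\<close> Suc mem_Collect_eq prod.case shift by force
      qed
    qed
  qed
  have "sign_changes (x # \<omega>) = card (?f ` ?A \<union> ?g ` ?B)"
    unfolding sign_changes_def split ..
  also have "\<dots> = card (?f ` ?A) + card (?g ` ?B)"
    using finA finB by (intro card_Un_disjoint) auto
  also have "card (?f ` ?A) = sign_changes \<omega>"
    unfolding sign_changes_def by (rule card_image) (auto simp: inj_on_def)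
  also have "card (?g ` ?B) = card ?B"
    by (rule card_image) (auto simp: inj_on_def)
  also have "card ?B = of_bool (\<exists>j. ?Q j)"
  proof (cases "\<exists>j. ?Q j")
    case True
    then obtain j where j: "?Q j" by blast
    have "j' = j" if "?Q j'" for j'
      using j that by (metis less_irrefl linorder_neqE_nat mult_zero_right)
    then have "?B = {j}" using j by blast
    then show ?thesis using True by simp
  qed auto
  finally show ?thesis by (simp add: conj_assoc)
qed

text \<open>
  A remembered sign \<open>s\<close> contributes one more alternation exactly if the first nonzero altitude is
  opposite to \<open>s\<close>.  That steps have size at most one is essential: it rules out a direct jump between
  opposite signs, which \<open>alternations\<close> would count and \<open>sign_changes\<close> would not.
\<close>

lemma alternations_eq:
  assumes "\<omega> \<in> walks_from x n"
  shows "alternations s \<omega> =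
    sign_changes \<omega> + of_bool (\<exists>j<length \<omega>. (\<forall>k<j. \<omega> ! k = 0) \<and> s * \<omega> ! j < 0)"
  using assms
proof (induction n arbitrary: \<omega> x s)
  case 0
  have "sign_changes [x] = card ({} :: (nat \<times> nat) set)"
    unfolding sign_changes_def by (rule arg_cong[where f = card]) auto
  then have "sign_changes [x] = 0"
    by simp
  with 0 show ?case by (auto simp: walks_from_0)
next
  case (Suc n)
  then obtain e \<omega>' where e: "e \<in> {-1, 0, 1}" "\<omega> = x # \<omega>'" "\<omega>' \<in> walks_from (x + e) n"
    unfolding walks_from_Suc by blast
  have start: "\<omega>' ! 0 = x + e" using e(3) by (simp add: walks_from_def)
  have IH: "alternations s \<omega>' =
    sign_changes \<omega>' + of_bool (\<exists>j<length \<omega>'. (\<forall>k<j. \<omega>' ! k = 0) \<and> s * \<omega>' ! j < 0)" for s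
    by (rule Suc.IH[OF e(3)])
  show ?case
  proof (cases "x = 0")
    case True
    then show ?thesis
      unfolding e(2) by (simp add: sign_changes_Cons IH Ex_less_Suc2 All_less_Suc2)
  next
    case False
    have first: "(\<exists>j<Suc (length \<omega>'). (\<forall>k<j. (x # \<omega>') ! k = 0) \<and> s * (x # \<omega>') ! j < 0) \<longleftrightarrow> s * x < 0"
      using False by (metis nth_Cons_0 zero_less_Suc gr0I not_less_zero)
    have opp: "\<not> sgn x * \<omega>' ! 0 < 0"
      using e(1) False unfolding start by (auto simp: sgn_if)
    have "sgn x * \<omega>' ! j < 0 \<longleftrightarrow> x * \<omega>' ! j < 0" for j
      by (auto simp: sgn_if mult_less_0_iff)
    then have "(\<exists>j<length \<omega>'. (\<forall>k<j. \<omega>' ! k = 0) \<and> sgn x * \<omega>' ! j < 0) \<longleftrightarrow>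
          (\<exists>j<length \<omega>'. j > 0 \<and> (\<forall>k<j. \<omega>' ! k = 0) \<and> x * \<omega>' ! j < 0)"
      using opp by (metis gr0I)
    then show ?thesis
      unfolding e(2) using False first by (simp add: sign_changes_Cons IH)
  qed
qed

lemma sign_changes_eq_alternations:
  assumes "\<omega> \<in> walks_from x n"
  shows "sign_changes \<omega> = alternations 0 \<omega>"
  by (simp add: alternations_eq[OF assms])

section \<open>Passage probabilities\<close>

text \<open>
  The probability that a walk with step probabilities \<open>g\<close> (up), \<open>z\<close> (level) and \<open>w\<close> (down) hits the
  altitude \<open>m\<close> within \<open>n\<close> steps, as a function of the time and the distance that remain.
\<close>

fun reach :: "real \<Rightarrow> real \<Rightarrow> real \<Rightarrow> nat \<Rightarrow> nat \<Rightarrow> real" where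
  "reach g z w n 0 = 1"
| "reach g z w 0 (Suc m) = 0"
| "reach g z w (Suc n) (Suc m) =
     g * reach g z w n m + z * reach g z w n (Suc m) + w * reach g z w n (Suc (Suc m))"

text \<open>
  The same probability for a walk whose clock already runs while it waits for a first nonzero step,
  which itself does not count towards the altitude \<open>m\<close>.
\<close>

fun late_reach :: "real \<Rightarrow> real \<Rightarrow> real \<Rightarrow> nat \<Rightarrow> nat \<Rightarrow> real" where
  "late_reach g z w 0 m = 0"
| "late_reach g z w (Suc n) m = z * late_reach g z w n m + (g + w) * reach g z w n m"

locale three_weights =
  fixes g z w :: real
  assumes pos: "g > 0" "z > 0" "w > 0" and total: "g + z + w = 1"
begin

lemma reach_bounds: "0 \<le> reach g z w n m" "reach g z w n m \<le> 1"
proof -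
  have "0 \<le> reach g z w n m \<and> reach g z w n m \<le> 1"
    using pos total
  proof (induction g z w n m rule: reach.induct)
    case (3 g z w n m)
    have "g * reach g z w n m + z * reach g z w n (Suc m) + w * reach g z w n (Suc (Suc m))
        \<le> g * 1 + z * 1 + w * 1"
      using 3 by (intro add_mono mult_left_mono) auto
    then show ?case using 3 by auto
  qed auto
  then show "0 \<le> reach g z w n m" "reach g z w n m \<le> 1" by auto
qed

lemma reach_Suc_le: "reach g z w n (Suc m) \<le> reach g z w n m"
proof (induction n arbitrary: m)
  case 0
  then show ?case by (cases m) auto
next
  case (Suc n)
  show ?case
  proof (cases m)
    case 0
    then show ?thesis by (simp only: reach.simps(1) reach_bounds)
  next
    case (Suc m')
    show ?thesis unfolding Suc reach.simps(3)
      using pos Suc.IH by (intro add_mono mult_left_mono) auto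
  qed
qed

lemma reach_le_Suc: "reach g z w n m \<le> reach g z w (Suc n) m"
proof (induction n arbitrary: m)
  case 0
  then show ?case using reach_bounds pos by (cases m) auto
next
  case (Suc n)
  show ?case
  proof (cases m)
    case (Suc m')
    show ?thesis unfolding Suc
      by (subst (1 2) reach.simps(3), intro add_mono mult_left_mono Suc.IH)
         (use pos in auto)
  qed simp
qed

lemma late_reach_le: "late_reach g z w n m \<le> reach g z w n m"
proof (induction n)
  case 0
  then show ?case by (simp add: reach_bounds)
next
  case (Suc n)
  have "late_reach g z w (Suc n) m \<le> z * reach g z w n m + (g + w) * reach g z w n m"
    using pos Suc by simp
  also have "\<dots> = (g + z + w) * reach g z w n m"
    by (simp add: algebra_simps)
  also have "\<dots> = reach g z w n m"
    by (simp add: total)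
  also have "\<dots> \<le> reach g z w (Suc n) m" by (rule reach_le_Suc)
  finally show ?case .
qed

text \<open>
  A late start costs no more than one additional level: at the first nonzero step a walk that aims at
  \<open>m + 1\<close> gets at best to distance \<open>m\<close>.
\<close>

lemma late_reach_ge: "reach g z w n (Suc m) \<le> late_reach g z w n m"
proof (induction n)
  case (Suc n)
  have "reach g z w (Suc n) (Suc m) \<le>
      g * reach g z w n m + z * late_reach g z w n m + w * reach g z w n m"
    unfolding reach.simps using pos Suc reach_Suc_le[of n "Suc m"] reach_Suc_le[of n m]
    by (intro add_mono mult_left_mono) auto
  then show ?case by (simp add: algebra_simps)
qed simp

text \<open>
  With upward drift every altitude is reached eventually.  For \<open>\<theta> = sqrt (w / g)\<close> the function
  \<open>\<theta>\<close> to the power minus \<open>m\<close> dominates the probability of failure at time \<open>0\<close>, and one step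
  multiplies it by \<open>\<phi> = g \<theta> + z + w / \<theta>\<close>; this choice of \<open>\<theta>\<close> minimises \<open>\<phi>\<close> and makes it less
  than one.
\<close>

lemma reach_tendsto_1:
  assumes "w < g"
  shows "(\<lambda>n. reach g z w n m) \<longlonglongrightarrow> 1"
proof -
  define \<theta> where "\<theta> = sqrt (w / g)"
  define \<phi> where "\<phi> = g * \<theta> + z + w / \<theta>"
  have \<theta>: "0 < \<theta>" "\<theta> < 1" using assms pos by (auto simp: \<theta>_def)
  have \<theta>2: "\<theta> * \<theta> = w / g" using pos by (simp add: \<theta>_def)
  have w1: "w / \<theta> = g * \<theta>" using \<theta>2 \<theta> pos by (simp add: field_simps)
  have "w = g * \<theta> * \<theta>" using \<theta>2 pos by (simp add: field_simps)
  then have z1: "z = 1 - g - g * \<theta> * \<theta>" using total by linarith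
  have "1 - \<phi> = g * (1 - \<theta>)\<^sup>2"
    unfolding \<phi>_def w1 z1 by (simp add: power2_eq_square algebra_simps)
  moreover have "g * (1 - \<theta>)\<^sup>2 > 0" using \<theta> pos by simp
  ultimately have \<phi>1: "\<phi> < 1" by simp
  have \<phi>0: "\<phi> > 0" using \<theta> pos by (simp add: \<phi>_def add_pos_pos)
  have bound: "1 - reach g z w n m \<le> \<phi> ^ n / \<theta> ^ m" for n m
  proof (induction n arbitrary: m)
    case 0
    have "1 \<le> 1 / \<theta> ^ m" using \<theta> by (simp add: power_le_one)
    then show ?case by (cases m) auto
  next
    case (Suc n)
    show ?case
    proof (cases m)
      case 0
      then show ?thesis using \<phi>0 by simp
    next
      case (Suc k)
      have "1 - reach g z w (Suc n) m = (g + z + w) - reach g z w (Suc n) m"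
        by (simp add: total)
      also have "\<dots> = g * (1 - reach g z w n k) +
          z * (1 - reach g z w n (Suc k)) + w * (1 - reach g z w n (Suc (Suc k)))"
        unfolding Suc by (simp add: algebra_simps)
      also have "\<dots> \<le> g * (\<phi> ^ n / \<theta> ^ k) + z * (\<phi> ^ n / \<theta> ^ Suc k) + w * (\<phi> ^ n / \<theta> ^ Suc (Suc k))"
        using pos by (intro add_mono mult_left_mono Suc.IH) auto
      also have "\<dots> = \<phi> ^ n * (g * \<theta> + z + w / \<theta>) / \<theta> ^ Suc k"
        using \<theta> by (simp add: field_simps)
      also have "\<dots> = \<phi> ^ Suc n / \<theta> ^ m"
        unfolding \<phi>_def[symmetric] Suc by (simp add: mult.commute)
      finally show ?thesis .
    qed
  qed
  have null: "(\<lambda>n. \<phi> ^ n / \<theta> ^ m) \<longlonglongrightarrow> 0 / \<theta> ^ m"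
    using \<phi>0 \<phi>1 \<theta> by (intro tendsto_divide LIMSEQ_power_zero tendsto_const) auto
  have "(\<lambda>n. 1 - reach g z w n m) \<longlonglongrightarrow> 0"
    by (rule tendsto_sandwich[of "\<lambda>_. 0" _ _ "\<lambda>n. \<phi> ^ n / \<theta> ^ m"])
       (use null in \<open>auto simp: bound reach_bounds\<close>)
  from tendsto_diff[OF tendsto_const this, of 1] show ?thesis by simp
qed

lemma late_reach_tendsto_1:
  assumes "w < g"
  shows "(\<lambda>n. late_reach g z w n m) \<longlonglongrightarrow> 1"
  by (rule tendsto_sandwich[OF _ _ reach_tendsto_1[OF assms, of "Suc m"] reach_tendsto_1[OF assms, of m]])
     (simp_all add: late_reach_ge late_reach_le)

end

section \<open>The law of the number of alternations\<close>

text \<open>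
  The price of \<open>k\<close> successive passages over two levels, from \<open>s\<close> to \<open>-s\<close>, back to \<open>s\<close> and so on,
  if each level travelled away from the side \<open>s\<close> costs a factor \<open>a s\<close>.
\<close>

fun crossing_cost :: "(int \<Rightarrow> real) \<Rightarrow> int \<Rightarrow> nat \<Rightarrow> real" where
  "crossing_cost a s 0 = 1"
| "crossing_cost a s (Suc k) = (a s)\<^sup>2 * crossing_cost a (-s) k"

text \<open>
  Sum and product determine \<open>g\<close> and \<open>w\<close> as the two weights \<open>p 1\<close> and \<open>p (-1)\<close> in some order.
  Stated in this symmetric way, the arguments treat both directions of the drift at once.
\<close>

locale oriented_weights = three_weights g z w for g z w +
  fixes p :: "int \<Rightarrow> real"
  assumes p0: "p 0 = z" and p_prod: "p 1 * p (-1) = g * w" and p_sum: "p 1 + p (-1) = g + w"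
begin

text \<open>
  The factor lost per level when passages away from the side \<open>s\<close> are compared with passages in the
  direction of weight \<open>g\<close>: it is \<open>1\<close> on one side and \<open>w / g\<close> on the other.
\<close>

definition level_cost :: "int \<Rightarrow> real" where
  "level_cost s = p (-s) / g"

text \<open>
  The remembered sign \<open>s\<close> need not be that of \<open>x\<close>: the value \<open>s = 0\<close> stands for a fresh start, and
  at \<open>x = -s\<close> an alternation has just been completed.
\<close>

definition tail :: "int \<Rightarrow> int \<Rightarrow> nat \<Rightarrow> nat \<Rightarrow> real" where
  "tail s x n k = walk_sum p x n (\<lambda>\<omega>. of_bool (k \<le> alternations s \<omega>))"

lemma p_total: "p (-1) + p 0 + p 1 = 1"
  using p0 p_sum total by simp

lemma tail_0: "tail s x n 0 = 1"
  using walk_sum_const[OF p_total, of x n "1::real"] by (simp add: tail_def)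

lemma tail_turn:
  assumes "s \<in> {-1, 1}"
  shows "tail s (-s) n (Suc k) = tail (-s) (-s) n k"
  unfolding tail_def
proof (rule walk_sum_cong)
  fix \<omega> assume "\<omega> \<in> walks_from (-s) n"
  then obtain \<omega>' where "\<omega> = (-s) # \<omega>'"
    by (cases \<omega>) (auto simp: walks_from_def)
  then show "of_bool (Suc k \<le> alternations s \<omega>) = (of_bool (k \<le> alternations (-s) \<omega>) :: real)"
    using assms by auto
qed

lemma tail_start:
  assumes "s \<in> {-1, 1}"
  shows "tail 0 s n k = tail s s n k"
  unfolding tail_def
proof (rule walk_sum_cong)
  fix \<omega> assume "\<omega> \<in> walks_from s n"
  then obtain \<omega>' where "\<omega> = s # \<omega>'"
    by (cases \<omega>) (auto simp: walks_from_def)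
  then show "of_bool (k \<le> alternations 0 \<omega>) = (of_bool (k \<le> alternations s \<omega>) :: real)"
    using assms by auto
qed

lemma tail_step:
  assumes "x = 0 \<or> sgn x = s"
  shows "tail s x (Suc n) k =
    p (-1) * tail s (x - 1) n k + p 0 * tail s x n k + p 1 * tail s (x + 1) n k"
proof -
  have "alternations s (x # \<omega>) = alternations s \<omega>" for \<omega>
  proof (cases "x = 0")
    case False
    with assms have "sgn x = s" "\<not> s * x < 0"
      by (auto simp: sgn_if mult_less_0_iff split: if_splits)
    then show ?thesis using False by simp
  qed simp
  then show ?thesis by (simp add: tail_def walk_sum_Suc)
qed

lemma p_neg: "p (-s) = level_cost s * g"
  using pos by (simp add: level_cost_def)

lemma p_mult: "s \<in> {-1, 1} \<Longrightarrow> p s * p (-s) = g * w"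
  using p_prod by (auto simp: mult.commute)

text \<open>
  A weighted reflection principle.  From the side \<open>s\<close> and at distance \<open>d\<close> from the altitude \<open>-s\<close>,
  \<open>k + 1\<close> alternations mean a passage over \<open>d\<close> levels and then \<open>k\<close> passages over two levels in
  alternating directions.  If the passages are reflected so that they all go in the direction of weight
  \<open>g\<close>, they add up to one passage over \<open>d + 2 * k\<close> levels.  A reflected passage over \<open>j\<close> levels has
  \<open>j\<close> more steps of weight \<open>g\<close> and \<open>j\<close> fewer of weight \<open>w\<close>, whatever its shape; this is why the
  change of weight is a factor that depends on the levels alone.
\<close>

lemma tail_eq_reach:
  assumes s: "s \<in> {-1, 1}"
  shows "tail s (s * (int d - 1)) n (Suc k) =
    level_cost s ^ d * crossing_cost level_cost (-s) k * reach g z w n (d + 2 * k)"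
  using s
proof (induction n arbitrary: s d k)
  case 0
  have "s * s = 1" using 0 by auto
  then have "s * (s * (int d - 1)) = int d - 1" by (metis mult.assoc mult_1)
  then have turn: "s * (s * (int d - 1)) < 0 \<longleftrightarrow> d = 0" and zero: "s * (int d - 1) = 0 \<longleftrightarrow> d = 1"
    using 0 by auto
  have "alternations s [s * (int d - 1)] = of_bool (d = 0)"
    by (simp only: alternations.simps turn zero) simp
  then show ?case
    by (cases d; cases k) (simp_all add: tail_def walk_sum_0)
next
  case (Suc n s d k)
  \<comment> \<open>The case \<open>d = 0\<close> turns at once into distance \<open>2\<close> for the opposite side at the same
      time, so the case of positive distance is needed for all sides first.\<close>
  have positive: "tail s (s * (int (Suc d) - 1)) (Suc n) (Suc k) =
      level_cost s ^ Suc d * crossing_cost level_cost (-s) k * reach g z w (Suc n) (Suc d + 2 * k)"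
    if s: "s \<in> {-1, 1}" for s d k
  proof -
    define x where "x = s * int d"
    have step: "tail s x (Suc n) (Suc k) =
      p (-s) * tail s (s * (int d - 1)) n (Suc k) +
      p 0 * tail s (s * (int (Suc d) - 1)) n (Suc k) +
      p s * tail s (s * (int (Suc (Suc d)) - 1)) n (Suc k)"
    proof -
      have eqs: "s * (int d - 1) = x - s" "s * (int (Suc d) - 1) = x" "s * (int (Suc (Suc d)) - 1) = x + s"
        by (simp_all add: x_def algebra_simps)
      have "x = 0 \<or> sgn x = s" using s by (auto simp: x_def sgn_if)
      then show ?thesis
        unfolding eqs using s tail_step[of x s n "Suc k"] by (elim insertE emptyE) simp_all
    qed
    have ps: "p s * level_cost s = w"
      using p_mult[OF s] pos by (simp add: level_cost_def)
    let ?c = "crossing_cost level_cost (-s) k" and ?r = "\<lambda>d. reach g z w n (d + 2 * k)"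
    have "tail s x (Suc n) (Suc k) =
        level_cost s * g * (level_cost s ^ d * ?c * ?r d) + z * (level_cost s ^ Suc d * ?c * ?r (Suc d)) +
        p s * (level_cost s ^ Suc (Suc d) * ?c * ?r (Suc (Suc d)))"
      unfolding step Suc.IH[OF s] p0 p_neg ..
    also have "\<dots> = level_cost s ^ Suc d * ?c * (g * ?r d + z * ?r (Suc d) + p s * level_cost s * ?r (Suc (Suc d)))"
      by (simp add: algebra_simps)
    finally show ?thesis
      unfolding ps x_def by simp
  qed
  show ?case
  proof (cases d)
    case (Suc d')
    then show ?thesis using positive[OF Suc.prems] by simp
  next
    case 0
    show ?thesis
    proof (cases k)
      case 0
      then show ?thesis
        using tail_turn[OF Suc.prems, of "Suc n" 0] \<open>d = 0\<close> by (simp add: tail_0)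
    next
      case (Suc k')
      have "-s \<in> {-1, 1}" using \<open>s \<in> {-1, 1}\<close> by auto
      from positive[OF this, of 1 k'] show ?thesis
        using tail_turn[OF Suc.prems, of "Suc n" k] \<open>d = 0\<close> unfolding Suc
        by (simp add: power2_eq_square)
    qed
  qed
qed

text \<open>
  If \<open>k\<close> is even, both sides cost \<open>(w / g) ^ k\<close>.  If \<open>k\<close> is odd, one side has one passage more in
  the direction of weight \<open>w\<close> than the other, but the average over the first nonzero step is
  again \<open>(w / g) ^ k\<close>.
\<close>

lemma crossing_cost_balance:
  "p 1 * crossing_cost level_cost 1 k + p (-1) * crossing_cost level_cost (-1) k = (g + w) * (w / g) ^ k"
proof (induction k)
  case 0
  then show ?case using p_sum by simp
next
  case (Suc k)
  have p1: "p 1 = level_cost (-1) * g" and p2: "p (-1) = level_cost 1 * g"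
    using pos by (simp_all add: level_cost_def)
  have aa: "level_cost 1 * level_cost (-1) = w / g"
    using p_prod pos unfolding p1 p2 by (simp add: field_simps)
  have "p 1 * crossing_cost level_cost 1 (Suc k) + p (-1) * crossing_cost level_cost (-1) (Suc k) =
      level_cost 1 * level_cost (-1) * (p 1 * crossing_cost level_cost 1 k + p (-1) * crossing_cost level_cost (-1) k)"
    unfolding p1 p2 by (simp add: power2_eq_square algebra_simps)
  then show ?case unfolding aa Suc by simp
qed

text \<open>
  A walk from the origin waits for its first nonzero step, which fixes the side, and then has to travel
  \<open>2 * k\<close> levels.  Time and number of alternations are thus separated: all dependence on \<open>n\<close> is in
  the second factor.
\<close>

lemma tail_origin:
  assumes "k > 0"
  shows "tail 0 0 n k = (w / g) ^ k * late_reach g z w n (2 * k)"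
proof (induction n)
  case 0
  then show ?case using assms by (simp add: tail_def walk_sum_0)
next
  case (Suc n)
  obtain k' where k: "k = Suc k'" using assms gr0_conv_Suc by blast
  have side: "tail 0 s n k = crossing_cost level_cost s k * reach g z w n (2 * k)" if "s \<in> {-1, 1}" for s
    using tail_eq_reach[OF that, of 2 n k'] that by (simp add: tail_start k)
  have "tail 0 0 (Suc n) k = p 0 * tail 0 0 n k +
      (p 1 * crossing_cost level_cost 1 k + p (-1) * crossing_cost level_cost (-1) k) * reach g z w n (2 * k)"
    by (subst tail_step) (simp_all add: side algebra_simps)
  also have "\<dots> = (w / g) ^ k * late_reach g z w (Suc n) (2 * k)"
    unfolding crossing_cost_balance p0 Suc by (simp add: algebra_simps)
  finally show ?case .
qed

end

section \<open>Weak convergence and the half-normal law\<close>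

lemma real_distribution_real_law: "real_distribution (real_law M f)"
  unfolding real_law_def by (rule prob_space.real_distribution_distr[OF prob_space_measure_pmf]) simp

lemma cdf_real_law: "cdf (real_law M f) x = measure_pmf.prob M {\<omega>. f \<omega> \<le> x}"
  unfolding cdf_def real_law_def by (subst measure_distr) (auto simp: vimage_def)

text \<open>
  Thresholds that vary with \<open>n\<close> are harmless because the limit has no atoms: they can be squeezed
  between two fixed ones.
\<close>

lemma weak_conv_upper_tail:
  assumes M: "\<And>n. real_distribution (M n)" and N: "real_distribution N"
    and conv: "weak_conv_m M N" and cont: "\<And>x. isCont (cdf N) x" and y: "y \<longlonglongrightarrow> l"
  shows "(\<lambda>n. measure (M n) {y n..}) \<longlonglongrightarrow> 1 - cdf N l"
proof (rule tendstoI)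
  interpret M: real_distribution "M n" for n by fact
  have tail: "measure (M n) {x<..} = 1 - cdf (M n) x" for n x
  proof -
    have "{x<..} = space (M n) - {..x}" by auto
    moreover have "measure (M n) (space (M n) - {..x}) = 1 - measure (M n) {..x}"
      by (rule M.prob_compl) simp
    ultimately show ?thesis by (simp add: cdf_def)
  qed
  fix e :: real assume e: "e > 0"
  have "cdf N \<midarrow>l\<rightarrow> cdf N l" using cont[of l] by (simp add: isCont_def)
  from LIM_D[OF this, of "e / 2"] e obtain d0 where d0: "d0 > 0"
      "\<And>x. x \<noteq> l \<Longrightarrow> norm (x - l) < d0 \<Longrightarrow> norm (cdf N x - cdf N l) < e / 2"
    by auto
  define d where "d = d0 / 2"
  have d: "d > 0" "\<bar>cdf N (l - d) - cdf N l\<bar> < e / 2" "\<bar>cdf N (l + d) - cdf N l\<bar> < e / 2"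
    using d0(1) d0(2)[of "l - d"] d0(2)[of "l + d"] by (auto simp: d_def)
  have lim: "(\<lambda>n. cdf (M n) x) \<longlonglongrightarrow> cdf N x" for x
    using conv cont by (auto simp: weak_conv_m_def weak_conv_def)
  have ev: "\<forall>\<^sub>F n in sequentially. \<bar>cdf (M n) x - cdf N x\<bar> < e / 2" for x
    using tendstoD[OF lim[of x], of "e / 2"] e by (simp add: dist_real_def)
  have "\<forall>\<^sub>F n in sequentially. \<bar>y n - l\<bar> < d"
    using tendstoD[OF y d(1)] by (simp add: dist_real_def)
  then show "\<forall>\<^sub>F n in sequentially. dist (measure (M n) {y n..}) (1 - cdf N l) < e"
    using ev[of "l - d"] ev[of "l + d"]
  proof eventually_elim
    case (elim n)
    have "measure (M n) {y n..} \<le> measure (M n) {l - d<..}"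
      using elim(1) by (intro M.finite_measure_mono) auto
    moreover have "measure (M n) {l + d<..} \<le> measure (M n) {y n..}"
      using elim(1) by (intro M.finite_measure_mono) auto
    ultimately show ?case
      using elim(2,3) d(2,3) unfolding tail dist_real_def by linarith
  qed
qed

lemma isCont_cdf_std_normal: "isCont (cdf std_normal_distribution) x"
proof -
  interpret real_distribution std_normal_distribution by (rule real_dist_normal_dist)
  have "emeasure std_normal_distribution {x} = 0"
    by (subst emeasure_density) (auto intro!: nn_integral_null_set simp: null_sets_def)
  then show ?thesis by (simp add: isCont_cdf measure_def)
qed

text \<open>
  By symmetry of the density and because there is no atom at \<open>0\<close>.
\<close>

lemma prob_std_normal_neg: "measure std_normal_distribution {..<0} = 1 / 2"
proof -
  interpret N: real_distribution std_normal_distribution by (rule real_dist_normal_dist)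
  have "emeasure std_normal_distribution {..<0} =
      (\<integral>\<^sup>+x. ennreal (std_normal_density x) * indicator {..<0} x \<partial>lborel)"
    by (simp add: emeasure_density)
  also have "\<dots> = (\<integral>\<^sup>+x. ennreal (std_normal_density (- x)) * indicator {..<0} (- x) \<partial>lborel)"
    by (subst nn_integral_real_affine[where c = "-1" and t = 0]) auto
  also have "\<dots> = (\<integral>\<^sup>+x. ennreal (std_normal_density x) * indicator {0<..} x \<partial>lborel)"
    by (intro nn_integral_cong) (auto simp: normal_density_def indicator_def)
  also have "\<dots> = emeasure std_normal_distribution {0<..}"
    by (simp add: emeasure_density)
  finally have "N.prob {..<0} = N.prob {0<..}" by (simp add: measure_def)
  also have "\<dots> = 1 - N.prob {..0}"
  proof -
    have "{0<..} = space std_normal_distribution - {..0::real}" by auto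
    moreover have "N.prob (space std_normal_distribution - {..0}) = 1 - N.prob {..0}"
      by (rule N.prob_compl) simp
    ultimately show ?thesis by simp
  qed
  also have "N.prob {..0} = N.prob {..<0}"
  proof -
    have "N.prob {0} = 0" using isCont_cdf_std_normal[of 0] by (simp add: N.isCont_cdf)
    moreover have "N.prob ({..<0} \<union> {0}) = N.prob {..<0} + N.prob {0}"
      by (rule N.finite_measure_Union) auto
    moreover have "{..0} = {..<0} \<union> {0::real}" by auto
    ultimately show ?thesis by simp
  qed
  finally show ?thesis by simp
qed

definition half_normal_density :: "real \<Rightarrow> real \<Rightarrow> real" where
  "half_normal_density \<sigma> y = (if y \<ge> 0 then sqrt (2 / (pi * \<sigma>\<^sup>2)) * exp (- y\<^sup>2 / (2 * \<sigma>\<^sup>2)) else 0)"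

lemma borel_measurable_half_normal_density [measurable]:
  "half_normal_density \<sigma> \<in> borel_measurable borel"
  unfolding half_normal_density_def[abs_def] by measurable

lemma half_normal_density_scale:
  assumes "\<sigma> > 0"
  shows "\<sigma> * half_normal_density \<sigma> (\<sigma> * y) = (if y \<ge> 0 then 2 * std_normal_density y else 0)"
proof -
  have "\<sigma> * sqrt (2 / (pi * \<sigma>\<^sup>2)) = 2 / sqrt (2 * pi)"
    using assms by (simp add: real_sqrt_divide real_sqrt_mult field_simps)
  moreover have "- (\<sigma> * y)\<^sup>2 / (2 * \<sigma>\<^sup>2) = - y\<^sup>2 / 2"
    using assms by (simp add: power_mult_distrib)
  moreover have "\<sigma> * y \<ge> 0 \<longleftrightarrow> y \<ge> 0"
    using assms by (simp add: zero_le_mult_iff)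
  ultimately show ?thesis
    by (simp add: half_normal_density_def normal_density_def flip: mult.assoc)
qed

lemma cdf_half_normal:
  assumes \<sigma>: "\<sigma> > 0"
  shows "cdf (half_normal \<sigma>) x =
    (if x < 0 then 0 else 2 * cdf std_normal_distribution (x / \<sigma>) - 1)"
proof -
  interpret N: real_distribution std_normal_distribution by (rule real_dist_normal_dist)
  let ?f = "\<lambda>y. ennreal (half_normal_density \<sigma> y) * indicator {..x} y"
  have "emeasure (half_normal \<sigma>) {..x} = (\<integral>\<^sup>+y. ?f y \<partial>lborel)"
    unfolding half_normal_def half_normal_density_def[symmetric] by (simp add: emeasure_density)
  also have "\<dots> = ennreal \<sigma> * (\<integral>\<^sup>+y. ?f (\<sigma> * y) \<partial>lborel)"
    using \<sigma> by (subst nn_integral_real_affine[of ?f \<sigma> 0]) auto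
  also have "\<dots> = (\<integral>\<^sup>+y. ennreal \<sigma> * ?f (\<sigma> * y) \<partial>lborel)"
    by (rule nn_integral_cmult[symmetric]) measurable
  also have "\<dots> = (\<integral>\<^sup>+y. 2 * (ennreal (std_normal_density y) * indicator {0..x / \<sigma>} y) \<partial>lborel)"
  proof (rule nn_integral_cong)
    fix y :: real
    have "ennreal \<sigma> * ?f (\<sigma> * y) =
        ennreal (\<sigma> * half_normal_density \<sigma> (\<sigma> * y)) * indicator {..x} (\<sigma> * y)"
      using \<sigma> by (simp add: ennreal_mult' mult.assoc)
    also have "\<dots> = 2 * (ennreal (std_normal_density y) * indicator {0..x / \<sigma>} y)"
      unfolding half_normal_density_scale[OF \<sigma>]
      using \<sigma> by (auto simp: indicator_def ennreal_mult' field_simps)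
    finally show "ennreal \<sigma> * ?f (\<sigma> * y) =
        2 * (ennreal (std_normal_density y) * indicator {0..x / \<sigma>} y)" .
  qed
  also have "\<dots> = 2 * emeasure std_normal_distribution {0..x / \<sigma>}"
    by (subst nn_integral_cmult) (simp_all add: emeasure_density)
  finally have half: "cdf (half_normal \<sigma>) x = 2 * N.prob {0..x / \<sigma>}"
    by (simp add: cdf_def measure_def enn2real_mult)
  show ?thesis
  proof (cases "x < 0")
    case True
    then have "{0..x / \<sigma>} = {}" using \<sigma> by (auto simp: divide_less_0_iff)
    then show ?thesis using half True by simp
  next
    case False
    have "N.prob ({..<0} \<union> {0..x / \<sigma>}) = N.prob {..<0} + N.prob {0..x / \<sigma>}"
      by (rule N.finite_measure_Union) auto
    moreover have "0 \<le> x / \<sigma>" using False \<sigma> by simp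
    then have "{..x / \<sigma>} = {..<0} \<union> {0..x / \<sigma>}" by auto
    ultimately show ?thesis
      using False half by (simp add: prob_std_normal_neg cdf_def)
  qed
qed

section \<open>The endpoint of a symmetric walk\<close>

lemma walk_sum_last_Suc:
  "walk_sum p x (Suc n) (\<lambda>\<omega>. f (last \<omega>)) =
     p (-1) *\<^sub>R walk_sum p (x - 1) n (\<lambda>\<omega>. f (last \<omega>)) +
     p 0 *\<^sub>R walk_sum p x n (\<lambda>\<omega>. f (last \<omega>)) +
     p 1 *\<^sub>R walk_sum p (x + 1) n (\<lambda>\<omega>. f (last \<omega>))"
proof -
  have "walk_sum p y n (\<lambda>\<omega>. f (last (x # \<omega>))) = walk_sum p y n (\<lambda>\<omega>. f (last \<omega>))" for y
    by (rule walk_sum_cong) (auto simp: walks_from_def)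
  then show ?thesis by (simp only: walk_sum_Suc)
qed

lemma walk_sum_last_shift:
  "walk_sum p (x + c) n (\<lambda>\<omega>. f (last \<omega>)) = walk_sum p x n (\<lambda>\<omega>. f (last \<omega> + c))"
proof (induction n arbitrary: x)
  case 0
  then show ?case by (simp add: walk_sum_0)
next
  case (Suc n)
  have "x + c - 1 = (x - 1) + c" "x + c + 1 = (x + 1) + c" by simp_all
  then show ?case
    unfolding walk_sum_last_Suc[of _ _ _ f] walk_sum_last_Suc[of _ _ _ "\<lambda>y. f (y + c)"]
    by (simp only: Suc)
qed

lemma walk_sum_last_reflect:
  assumes "p 1 = p (-1)"
  shows "walk_sum p (-x) n (\<lambda>\<omega>. f (last \<omega>)) = walk_sum p x n (\<lambda>\<omega>. f (- last \<omega>))"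
proof (induction n arbitrary: x)
  case 0
  then show ?case by (simp add: walk_sum_0)
next
  case (Suc n)
  have "- x - 1 = - (x + 1)" "- x + 1 = - (x - 1)" by simp_all
  then show ?case
    unfolding walk_sum_last_Suc[of _ _ _ f] walk_sum_last_Suc[of _ _ _ "\<lambda>y. f (- y)"]
    by (simp only: Suc assms ac_simps)
qed

text \<open>
  The reflection principle: a symmetric walk that hits \<open>m\<close> ends above or below \<open>m\<close> with equal
  probability.  Both sides obey the same recursion for positive \<open>m\<close>, and at \<open>m = 0\<close> the right side is
  one by symmetry.
\<close>

lemma reach_reflection:
  assumes sym: "p 1 = p (-1)" and sum1: "p (-1) + p 0 + p 1 = 1"
  shows "reach (p 1) (p 0) (p 1) n m =
    walk_sum p 0 n (\<lambda>\<omega>. of_bool (int m \<le> last \<omega>)) +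
    walk_sum p 0 n (\<lambda>\<omega>. of_bool (int (Suc m) \<le> last \<omega>))"
proof -
  define U where "U c x n = walk_sum p x n (\<lambda>\<omega>. of_bool (c \<le> last \<omega>) :: real)" for c x n
  have U_Suc: "U c x (Suc n) = p (-1) * U c (x - 1) n + p 0 * U c x n + p 1 * U c (x + 1) n" for c x n
    using walk_sum_last_Suc[of p x n "\<lambda>y. of_bool (c \<le> y) :: real"] by (simp add: U_def)
  have "reach (p 1) (p 0) (p 1) n m = U 0 (- int m) n + U 1 (- int m) n"
  proof (induction "p 1" "p 0" "p 1" n m rule: reach.induct)
    case (1 n)
    have "U 1 0 n = walk_sum p 0 n (\<lambda>\<omega>. of_bool (1 \<le> - last \<omega>) :: real)"
      using walk_sum_last_reflect[OF sym, of 0 n "\<lambda>y. of_bool (1 \<le> y) :: real"] by (simp add: U_def)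
    then have "U 0 0 n + U 1 0 n =
        walk_sum p 0 n (\<lambda>\<omega>. of_bool (0 \<le> last \<omega>) + of_bool (1 \<le> - last \<omega>) :: real)"
      by (simp add: U_def walk_sum_add)
    also have "\<dots> = walk_sum p 0 n (\<lambda>_. 1)"
      by (rule walk_sum_cong) auto
    also have "\<dots> = 1" by (rule walk_sum_const[OF sum1])
    finally show ?case by simp
  next
    case (2 m)
    then show ?case by (simp add: U_def walk_sum_0)
  next
    case (3 n m)
    have "- int (Suc m) - 1 = - int (Suc (Suc m))" "- int (Suc m) + 1 = - int m" by simp_all
    then show ?case
      by (simp only: U_Suc reach.simps 3) (simp add: sym algebra_simps)
  qed
  moreover have "U c (- int m) n = walk_sum p 0 n (\<lambda>\<omega>. of_bool (c + int m \<le> last \<omega>) :: real)" for c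
    using walk_sum_last_shift[of p 0 "- int m" n "\<lambda>y. of_bool (c \<le> y) :: real"]
    by (simp add: U_def algebra_simps)
  ultimately show ?thesis by (simp add: add.commute)
qed

lemma walk_sum_iexp:
  assumes sym: "p 1 = p (-1)"
  shows "walk_sum p x n (\<lambda>\<omega>. iexp (t * real_of_int (last \<omega>))) =
    iexp (t * real_of_int x) * complex_of_real (p 0 + 2 * p 1 * cos t) ^ n"
proof (induction n arbitrary: x)
  case 0
  then show ?case by (simp add: walk_sum_0)
next
  case (Suc n)
  let ?\<phi> = "complex_of_real (p 0 + 2 * p 1 * cos t)"
  have shift: "iexp (t * real_of_int (x + 1)) = iexp (t * real_of_int x) * iexp t"
      "iexp (t * real_of_int (x - 1)) = iexp (t * real_of_int x) * iexp (- t)"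
    by (simp_all add: algebra_simps flip: exp_add)
  have cos: "iexp t + iexp (- t) = 2 * complex_of_real (cos t)"
    by (simp add: complex_eq_iff Re_exp Im_exp)
  have "walk_sum p x (Suc n) (\<lambda>\<omega>. iexp (t * real_of_int (last \<omega>))) =
      iexp (t * real_of_int x) * ?\<phi> ^ n * (p 0 + p 1 * (iexp t + iexp (- t)))"
    unfolding walk_sum_last_Suc[of p x n "\<lambda>y. iexp (t * real_of_int y)"] Suc shift
    by (simp add: sym scaleR_conv_of_real algebra_simps)
  then show ?case
    unfolding cos by (simp add: algebra_simps)
qed

lemma char_endpoint:
  assumes p: "p (-1) > 0" "p 0 > 0" "p 1 > 0" and sum1: "p (-1) + p 0 + p 1 = 1"
    and sym: "p 1 = p (-1)"
  shows "char (real_law (random_walk p n) (\<lambda>\<omega>. real_of_int (last \<omega>) / c)) t =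
    complex_of_real ((1 - 2 * p 1 * (1 - cos (t / c))) ^ n)"
proof -
  have "char (real_law (random_walk p n) (\<lambda>\<omega>. real_of_int (last \<omega>) / c)) t =
      (\<integral>\<omega>. iexp (t / c * real_of_int (last \<omega>)) \<partial>measure_pmf (random_walk p n))"
    unfolding char_def real_law_def by (subst integral_distr) auto
  also have "\<dots> = complex_of_real (p 0 + 2 * p 1 * cos (t / c)) ^ n"
    unfolding integral_random_walk[OF p sum1] walk_sum_iexp[where t = "t / c", OF sym] by simp
  also have "p 0 + 2 * p 1 * cos (t / c) = 1 - 2 * p 1 * (1 - cos (t / c))"
    using sum1 sym by (simp add: algebra_simps)
  finally show ?thesis by simp
qed

text \<open>
  The limit of the characteristic function in the central limit theorem for a symmetric walk with
  steps of variance \<open>v\<close>.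
\<close>

lemma one_minus_cos_power_limit:
  "(\<lambda>n::nat. (1 - v * (1 - cos (a / sqrt (real n)))) ^ n) \<longlonglongrightarrow> exp (- (v * a\<^sup>2 / 2))"
  by real_asymp (simp add: power2_eq_square)

text \<open>
  The recursion for the walk gives the characteristic function of its endpoint in closed form, so
  Levy's continuity theorem applies directly and no sequence of independent steps has to be
  constructed.
\<close>

lemma endpoint_clt:
  assumes p: "p (-1) > 0" "p 0 > 0" "p 1 > 0" and sum1: "p (-1) + p 0 + p 1 = 1"
    and sym: "p 1 = p (-1)"
  shows "weak_conv_m
    (\<lambda>n. real_law (random_walk p n) (\<lambda>\<omega>. real_of_int (last \<omega>) / (sqrt (real n) * sqrt (2 * p 1))))
    std_normal_distribution"
proof (rule levy_continuity[OF real_distribution_real_law real_dist_normal_dist])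
  fix t
  define \<sigma> where "\<sigma> = sqrt (2 * p 1)"
  have \<sigma>: "\<sigma> > 0" "\<sigma>\<^sup>2 = 2 * p 1" using p by (auto simp: \<sigma>_def)
  have "t / \<sigma> / sqrt (real n) = t / (sqrt (real n) * \<sigma>)" for n
    by (simp add: mult.commute)
  moreover have "2 * p 1 * (t / \<sigma>)\<^sup>2 = t\<^sup>2" using \<sigma> by (simp add: power_divide flip: \<sigma>(2))
  ultimately have "(\<lambda>n. (1 - 2 * p 1 * (1 - cos (t / (sqrt (real n) * \<sigma>)))) ^ n) \<longlonglongrightarrow> exp (- (t\<^sup>2 / 2))"
    using one_minus_cos_power_limit[of "2 * p 1" "t / \<sigma>"] by (simp only:)
  from tendsto_of_real[OF this]
  show "(\<lambda>n. char (real_law (random_walk p n)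
      (\<lambda>\<omega>. real_of_int (last \<omega>) / (sqrt (real n) * sqrt (2 * p 1)))) t)
      \<longlonglongrightarrow> char std_normal_distribution t"
    unfolding char_endpoint[OF p sum1 sym] char_std_normal_distribution \<sigma>_def[symmetric] by simp
qed

lemma reach_scaling_limit:
  fixes p :: "int \<Rightarrow> real"
  assumes p: "p (-1) > 0" "p 0 > 0" "p 1 > 0" and sum1: "p (-1) + p 0 + p 1 = 1"
    and sym: "p 1 = p (-1)"
    and m: "(\<lambda>n. real (m n) / sqrt (real n)) \<longlonglongrightarrow> c"
  shows "(\<lambda>n. reach (p 1) (p 0) (p 1) n (m n)) \<longlonglongrightarrow>
    2 * (1 - cdf std_normal_distribution (c / sqrt (2 * p 1)))"
proof -
  define \<sigma> where "\<sigma> = sqrt (2 * p 1)"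
  have \<sigma>: "\<sigma> > 0" using p by (auto simp: \<sigma>_def)
  let ?L = "\<lambda>n. real_law (random_walk p n) (\<lambda>\<omega>. real_of_int (last \<omega>) / (sqrt (real n) * \<sigma>))"
  have upper: "(\<lambda>n. walk_sum p 0 n (\<lambda>\<omega>. of_bool (int (k n) \<le> last \<omega>)) :: real) \<longlonglongrightarrow>
      1 - cdf std_normal_distribution (c / \<sigma>)"
    if k: "(\<lambda>n. real (k n) / sqrt (real n)) \<longlonglongrightarrow> c" for k
  proof (rule Lim_transform_eventually)
    have "(\<lambda>n. real (k n) / sqrt (real n) / \<sigma>) \<longlonglongrightarrow> c / \<sigma>"
      using k \<sigma> by (intro tendsto_divide tendsto_const) auto
    then show "(\<lambda>n. measure (?L n) {real (k n) / sqrt (real n) / \<sigma>..}) \<longlonglongrightarrow>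
        1 - cdf std_normal_distribution (c / \<sigma>)"
      using endpoint_clt[OF p sum1 sym] unfolding \<sigma>_def[symmetric]
      by (intro weak_conv_upper_tail real_distribution_real_law real_dist_normal_dist
          isCont_cdf_std_normal)
    show "\<forall>\<^sub>F n in sequentially. measure (?L n) {real (k n) / sqrt (real n) / \<sigma>..} =
        walk_sum p 0 n (\<lambda>\<omega>. of_bool (int (k n) \<le> last \<omega>))"
      using eventually_gt_at_top[of 0]
    proof eventually_elim
      case (elim n)
      have "real (k n) / sqrt (real n) / \<sigma> \<le> real_of_int y / (sqrt (real n) * \<sigma>) \<longleftrightarrow> int (k n) \<le> y" for y
      proof -
        have "sqrt (real n) * \<sigma> > 0" using elim \<sigma> by simp
        then have "real (k n) / (sqrt (real n) * \<sigma>) \<le> real_of_int y / (sqrt (real n) * \<sigma>) \<longleftrightarrow>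
            real (k n) \<le> real_of_int y"
          by (simp add: divide_le_cancel)
        then show ?thesis by simp linarith
      qed
      then show ?case
        unfolding prob_random_walk[OF p sum1, symmetric] real_law_def
        by (subst measure_distr) (auto simp: vimage_def)
    qed
  qed
  have "(\<lambda>n. real (m n) / sqrt (real n) + 1 / sqrt (real n)) \<longlonglongrightarrow> c + 0"
    by (intro tendsto_add m) real_asymp
  then have "(\<lambda>n. real (Suc (m n)) / sqrt (real n)) \<longlonglongrightarrow> c"
    by (simp add: add_divide_distrib add.commute)
  from tendsto_add[OF upper[OF m] upper[OF this]] show ?thesis
    unfolding reach_reflection[OF sym sum1] \<sigma>_def by simp
qed

section \<open>Limit laws of the number of sign changes\<close>

lemma prob_real_le_eq:
  fixes X :: "'a \<Rightarrow> nat"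
  assumes "y \<ge> 0"
  shows "measure_pmf.prob M {\<omega>. real (X \<omega>) \<le> y} =
    1 - measure_pmf.prob M {\<omega>. Suc (nat \<lfloor>y\<rfloor>) \<le> X \<omega>}"
proof -
  have "{\<omega>. real (X \<omega>) \<le> y} = space (measure_pmf M) - {\<omega>. Suc (nat \<lfloor>y\<rfloor>) \<le> X \<omega>}"
    using assms by (auto simp: Suc_le_eq nat_less_iff floor_less_iff)
  then show ?thesis
    using measure_pmf.prob_compl[of "{\<omega>. Suc (nat \<lfloor>y\<rfloor>) \<le> X \<omega>}" M] by simp
qed

lemma prob_geometric_ge:
  assumes "0 < \<theta>" "\<theta> < 1"
  shows "measure_pmf.prob (geometric_pmf (1 - \<theta>)) {i. k \<le> i} = \<theta> ^ k"
proof -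
  have "measure_pmf.prob (geometric_pmf (1 - \<theta>)) {..<k} = (\<Sum>i<k. \<theta> ^ i * (1 - \<theta>))"
    using assms by (simp add: measure_measure_pmf_finite)
  also have "\<dots> = 1 - \<theta> ^ k"
    using assms by (simp add: sum_gp_strict flip: sum_distrib_right)
  finally have "measure_pmf.prob (geometric_pmf (1 - \<theta>)) {..<k} = 1 - \<theta> ^ k" .
  moreover have "{i. k \<le> i} = space (geometric_pmf (1 - \<theta>)) - {..<k}" by auto
  ultimately show ?thesis
    using measure_pmf.prob_compl[of "{..<k}" "geometric_pmf (1 - \<theta>)"] by simp
qed

text \<open>
  Both limits are read off from this exact law: with drift the second factor tends to one, without
  drift the first factor equals one.
\<close>

lemma prob_sign_changes_ge:
  assumes p: "p (-1) > 0" "p 0 > 0" "p 1 > 0" and sum1: "p (-1) + p 0 + p 1 = 1"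
    and k: "k > 0"
  defines "g \<equiv> max (p 1) (p (-1))" and "w \<equiv> min (p 1) (p (-1))"
  shows "measure_pmf.prob (random_walk p n) {\<omega>. k \<le> sign_changes \<omega>} =
    (w / g) ^ k * late_reach g (p 0) w n (2 * k)"
proof -
  interpret oriented_weights g "p 0" w p
    by standard (use p sum1 in \<open>auto simp: g_def w_def max_def min_def\<close>)
  have "measure_pmf.prob (random_walk p n) {\<omega>. k \<le> sign_changes \<omega>} = tail 0 0 n k"
    unfolding prob_random_walk[OF p sum1] tail_def
    by (rule walk_sum_cong) (simp add: sign_changes_eq_alternations)
  then show ?thesis using tail_origin[OF k] by simp
qed

text \<open>
  With nonzero drift the larger weight \<open>g\<close> drives the reflected walk upwards, so the time constraint
  disappears in the limit and the tail \<open>(w / g) ^ k\<close> of a geometric law remains.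
\<close>

lemma sign_changes_geometric_limit:
  assumes p: "p (-1) > 0" "p 0 > 0" "p 1 > 0" and sum1: "p (-1) + p 0 + p 1 = 1"
    and drift: "p 1 \<noteq> p (-1)"
  shows "weak_conv_m (\<lambda>n. real_law (random_walk p n) (\<lambda>\<omega>. real (sign_changes \<omega>)))
    (real_law (geometric_pmf (1 - min (p 1) (p (-1)) / max (p 1) (p (-1)))) real)"
  unfolding weak_conv_m_def weak_conv_def
proof (intro allI impI)
  fix x :: real
  define g w where "g = max (p 1) (p (-1))" and "w = min (p 1) (p (-1))"
  define k where "k = Suc (nat \<lfloor>x\<rfloor>)"
  interpret three_weights g "p 0" w
    by standard (use p sum1 in \<open>auto simp: g_def w_def max_def min_def\<close>)
  have wg: "w < g" using drift by (auto simp: g_def w_def)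
  then have ratio: "0 < w / g" "w / g < 1" using pos by auto
  show "(\<lambda>n. cdf (real_law (random_walk p n) (\<lambda>\<omega>. real (sign_changes \<omega>))) x) \<longlonglongrightarrow>
      cdf (real_law (geometric_pmf (1 - min (p 1) (p (-1)) / max (p 1) (p (-1)))) real) x"
    unfolding g_def[symmetric] w_def[symmetric]
  proof (cases "x < 0")
    case True
    then have "\<not> real i \<le> x" for i by (simp add: not_le order_less_le_trans)
    then show "(\<lambda>n. cdf (real_law (random_walk p n) (\<lambda>\<omega>. real (sign_changes \<omega>))) x) \<longlonglongrightarrow>
        cdf (real_law (geometric_pmf (1 - w / g)) real) x"
      by (simp add: cdf_real_law)
  next
    case False
    have "(\<lambda>n. 1 - (w / g) ^ k * late_reach g (p 0) w n (2 * k)) \<longlonglongrightarrow> 1 - (w / g) ^ k * 1"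
      by (intro tendsto_intros late_reach_tendsto_1 wg)
    moreover have "cdf (real_law (random_walk p n) (\<lambda>\<omega>. real (sign_changes \<omega>))) x =
        1 - (w / g) ^ k * late_reach g (p 0) w n (2 * k)" for n
      using False prob_sign_changes_ge[OF p sum1, of k n]
      by (simp add: cdf_real_law prob_real_le_eq k_def g_def w_def del: late_reach.simps)
    moreover have "cdf (real_law (geometric_pmf (1 - w / g)) real) x = 1 - (w / g) ^ k"
      using False prob_geometric_ge[OF ratio, of k]
      by (simp add: cdf_real_law prob_real_le_eq[where X = "\<lambda>i. i"] k_def)
    ultimately show "(\<lambda>n. cdf (real_law (random_walk p n) (\<lambda>\<omega>. real (sign_changes \<omega>))) x) \<longlonglongrightarrow>
        cdf (real_law (geometric_pmf (1 - w / g)) real) x"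
      by simp
  qed
qed

text \<open>
  Without drift \<open>w = g\<close>, and only the time constraint is left.  As \<open>k\<close> sign changes need \<open>2 * k\<close>
  levels, \<open>x * sqrt n\<close> sign changes correspond to the maximum of the walk exceeding
  \<open>2 * x * sqrt n\<close>; this is the origin of the factor \<open>1 / 2\<close> in the parameter of the limit.
\<close>

lemma sign_changes_half_normal_limit:
  assumes p: "p (-1) > 0" "p 0 > 0" "p 1 > 0" and sum1: "p (-1) + p 0 + p 1 = 1"
    and sym: "p 1 = p (-1)"
  shows "weak_conv_m
    (\<lambda>n. real_law (random_walk p n) (\<lambda>\<omega>. real (sign_changes \<omega>) / sqrt (real n)))
    (half_normal (1 / 2 * sqrt (2 * p 1)))"
  unfolding weak_conv_m_def weak_conv_def
proof (intro allI impI)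
  fix x :: real
  define \<sigma> where "\<sigma> = sqrt (2 * p 1)"
  have \<sigma>: "\<sigma> > 0" using p by (simp add: \<sigma>_def)
  let ?X = "\<lambda>n. cdf (real_law (random_walk p n) (\<lambda>\<omega>. real (sign_changes \<omega>) / sqrt (real n))) x"
  show "?X \<longlonglongrightarrow> cdf (half_normal (1 / 2 * sqrt (2 * p 1))) x"
    unfolding \<sigma>_def[symmetric]
  proof (cases "x < 0")
    case True
    have "\<not> real i / sqrt (real n) \<le> x" for i n
      using True by (simp add: not_le order_less_le_trans)
    then show "?X \<longlonglongrightarrow> cdf (half_normal (1 / 2 * \<sigma>)) x"
      using True \<sigma> by (simp add: cdf_real_law cdf_half_normal)
  next
    case False
    interpret three_weights "p 1" "p 0" "p 1"
      by standard (use p sum1 sym in auto)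
    define k where "k n = Suc (nat \<lfloor>x * sqrt (real n)\<rfloor>)" for n
    have k: "x * sqrt (real n) \<le> real (k n)" "real (k n) \<le> x * sqrt (real n) + 1" for n
      using False by (auto simp: k_def) linarith+
    have lim0: "(\<lambda>n. real (2 * k n) / sqrt (real n)) \<longlonglongrightarrow> 2 * x"
    proof (rule tendsto_sandwich)
      show "\<forall>\<^sub>F n in sequentially. 2 * x \<le> real (2 * k n) / sqrt (real n)"
        using eventually_gt_at_top[of 0]
        by eventually_elim (use k(1) in \<open>simp add: field_simps\<close>)
      show "\<forall>\<^sub>F n in sequentially. real (2 * k n) / sqrt (real n) \<le> 2 * x + 2 / sqrt (real n)"
        using eventually_gt_at_top[of 0]
      proof eventually_elim
        case (elim n)
        have "real (2 * k n) \<le> 2 * (x * sqrt (real n) + 1)" using k(2)[of n] by simp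
        then show ?case using elim by (simp add: field_simps)
      qed
      show "(\<lambda>n. 2 * x + 2 / sqrt (real n)) \<longlonglongrightarrow> 2 * x" by real_asymp
    qed simp
    have "(\<lambda>n. real (2 * k n) / sqrt (real n) + 1 / sqrt (real n)) \<longlonglongrightarrow> 2 * x + 0"
      by (intro tendsto_add lim0) real_asymp
    then have lim1: "(\<lambda>n. real (Suc (2 * k n)) / sqrt (real n)) \<longlonglongrightarrow> 2 * x"
      by (simp add: add_divide_distrib add.commute)
    have "(\<lambda>n. late_reach (p 1) (p 0) (p 1) n (2 * k n)) \<longlonglongrightarrow>
        2 * (1 - cdf std_normal_distribution (2 * x / \<sigma>))"
      unfolding \<sigma>_def
      by (rule tendsto_sandwich[OF _ _ reach_scaling_limit[OF p sum1 sym lim1]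
            reach_scaling_limit[OF p sum1 sym lim0]])
         (simp_all add: late_reach_ge late_reach_le)
    from tendsto_diff[OF tendsto_const this, of 1]
    have "(\<lambda>n. 1 - late_reach (p 1) (p 0) (p 1) n (2 * k n)) \<longlonglongrightarrow>
        cdf (half_normal (1 / 2 * \<sigma>)) x"
      using False \<sigma> by (simp add: cdf_half_normal mult.commute)
    moreover have "\<forall>\<^sub>F n in sequentially. 1 - late_reach (p 1) (p 0) (p 1) n (2 * k n) = ?X n"
      using eventually_gt_at_top[of 0]
    proof eventually_elim
      case (elim n)
      have "?X n = measure_pmf.prob (random_walk p n) {\<omega>. real (sign_changes \<omega>) \<le> x * sqrt (real n)}"
        using elim by (simp add: cdf_real_law field_simps)
      also have "\<dots> = 1 - measure_pmf.prob (random_walk p n) {\<omega>. k n \<le> sign_changes \<omega>}"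
        using False by (simp add: prob_real_le_eq k_def)
      also have "\<dots> = 1 - late_reach (p 1) (p 0) (p 1) n (2 * k n)"
        using prob_sign_changes_ge[OF p sum1, of "k n" n] p sym by (simp add: k_def)
      finally show ?case ..
    qed
    ultimately show "?X \<longlonglongrightarrow> cdf (half_normal (1 / 2 * \<sigma>)) x"
      by (rule Lim_transform_eventually)
  qed
qed

section \<open>The jump polynomial\<close>

lemma deriv_jump_poly:
  assumes "u \<noteq> 0"
  shows "deriv (jump_poly p) u = p 1 - p (-1) / u\<^sup>2"
proof (rule DERIV_imp_deriv)
  show "(jump_poly p has_field_derivative p 1 - p (-1) / u\<^sup>2) (at u)"
    unfolding jump_poly_def[abs_def] using assms
    by (auto intro!: derivative_eq_intros simp: power2_eq_square)
qed

lemma deriv_deriv_jump_poly: "deriv (deriv (jump_poly p)) 1 = 2 * p (-1)"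
proof -
  have "\<forall>\<^sub>F u in nhds 1. u \<in> - {0::real}"
    by (rule eventually_nhds_in_open) auto
  then have "\<forall>\<^sub>F u in nhds 1. deriv (jump_poly p) u = p 1 - p (-1) / u\<^sup>2"
    by eventually_elim (simp add: deriv_jump_poly)
  then have "deriv (deriv (jump_poly p)) 1 = deriv (\<lambda>u. p 1 - p (-1) / u\<^sup>2) 1"
    by (rule deriv_cong_ev) simp
  also have "\<dots> = 2 * p (-1)"
    by (rule DERIV_imp_deriv) (auto intro!: derivative_eq_intros)
  finally show ?thesis .
qed

theorem theorem4p8:
  fixes p :: "int \<Rightarrow> real"
  assumes "p (-1) > 0" and "p 0 > 0" and "p 1 > 0"
  shows "(drift p \<noteq> 0 \<longrightarrow>
            weak_conv_m (\<lambda>n. real_law (random_walk p n) (\<lambda>\<omega>. real (sign_changes \<omega>)))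
                        (real_law (geometric_pmf (1 - geom_ratio p)) real)) \<and>
         (drift p = 0 \<longrightarrow>
            weak_conv_m (\<lambda>n. real_law (random_walk p n) (\<lambda>\<omega>. real (sign_changes \<omega>) / sqrt (real n)))
                        (half_normal (1 / 2 * sqrt (deriv (deriv (jump_poly p)) 1 / jump_poly p 1))))"
proof -
  define c where "c = jump_poly p 1"
  define q where "q = (\<lambda>e. p e / c)"
  have c: "c = p (-1) + p 0 + p 1" by (simp add: c_def jump_poly_def)
  then have c_pos: "c > 0" using assms by simp
  have q: "q (-1) > 0" "q 0 > 0" "q 1 > 0" using assms c_pos by (simp_all add: q_def)
  have sum1: "q (-1) + q 0 + q 1 = 1"
    using c_pos unfolding q_def c by (simp flip: add_divide_distrib)
  have walk: "random_walk p n = random_walk q n" for n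
    unfolding q_def by (rule random_walk_scale[OF c_pos assms, symmetric])
  have drift: "drift p = p 1 - p (-1)"
    by (simp add: drift_def deriv_jump_poly)
  have ratio: "geom_ratio p = min (q 1) (q (-1)) / max (q 1) (q (-1))"
    using c_pos by (auto simp: geom_ratio_def drift q_def min_def max_def divide_le_cancel)
  have variance: "deriv (deriv (jump_poly p)) 1 / jump_poly p 1 = 2 * q 1" if "drift p = 0"
    using that by (simp add: deriv_deriv_jump_poly drift q_def c_def)
  show ?thesis
    unfolding walk ratio
  proof (intro conjI impI)
    assume "drift p \<noteq> 0"
    then have "q 1 \<noteq> q (-1)" using c_pos by (simp add: drift q_def)
    then show "weak_conv_m (\<lambda>n. real_law (random_walk q n) (\<lambda>\<omega>. real (sign_changes \<omega>)))
        (real_law (geometric_pmf (1 - min (q 1) (q (-1)) / max (q 1) (q (-1)))) real)"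
      by (rule sign_changes_geometric_limit[OF q sum1])
  next
    assume d: "drift p = 0"
    then have "q 1 = q (-1)" by (simp add: drift q_def)
    then show "weak_conv_m
        (\<lambda>n. real_law (random_walk q n) (\<lambda>\<omega>. real (sign_changes \<omega>) / sqrt (real n)))
        (half_normal (1 / 2 * sqrt (deriv (deriv (jump_poly p)) 1 / jump_poly p 1)))"
      unfolding variance[OF d] by (rule sign_changes_half_normal_limit[OF q sum1])
  qed
qed

end
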